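(* Let $n\ge1$. The restriction of $\Psi$ to $\mathfrak{S}_n(213)$ is a bijection from $\mathfrak{S}_n(213)$ onto $\mathfrak{S}_n(321)$.
   Context: $\mathfrak{S}_n(\tau)$ is the set of permutations of $[n]$ avoiding the classical pattern $\tau$. The map $\Phi:\mathfrak{S}_m\to\mathfrak{S}_m$: for $\rho\in\mathfrak{S}_m$, a letter $\rho(i)$ is a descent top if $i\le m-1$ and $\rho(i)>\rho(i+1)$, a descent bottom if $i\ge2$ and $\rho(i-1)>\rho(i)$; otherwise a nondescent top (resp. bottom). For $x=\rho(i)$ let $c(x)=\#\{j:i<j<m,\ \rho(j+1)<x<\rho(j)\}$. Let $f$ (resp. $g$) be the increasing word of descent bottoms (resp. nondescent bottoms); $f'$ the arrangement of descent tops in which each letter $x$ has exactly $c(x)$ larger letters to its left; $g'$ the arrangement of nondescent tops in which each letter $x$ has exactly $c(x)$ smaller letters to its right. With the two-row array of top row $fg$ and bottom row $f'g'$, $\Phi(\rho)=\tau$ with $\tau(b)=a$ for each column (top $a$, bottom $b$). The map $\Psi:\mathfrak{S}_n\to\mathfrak{S}_n$: for $\sigma\in\mathfrak{S}_n$ let $\hat\sigma\in\mathfrak{S}_{n+1}$, $\hat\sigma(i)=\sigma(i)+1$ for $i\le n$, $\hat\sigma(n+1)=1$; $\tau=\Phi(\hat\sigma)$ has $\tau(1)=n+1$, and $\Psi(\sigma)=\tau(2)\cdots\tau(n+1)$. *)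

theory Defs
  imports "HOL-Combinatorics.Multiset_Permutations"
begin

text \<open>Permutations of [n] are represented as lists (one-line notation) in
  permutations_of_set {1..n}, i.e. distinct lists with set {1..n}.
  A list position i is 1-based via rho.\<close>

definition rho :: "nat list \<Rightarrow> nat \<Rightarrow> nat" where
  "rho xs i = xs ! (i - 1)"

definition Sn :: "nat \<Rightarrow> nat list set" where
  "Sn n = permutations_of_set {1..n}"

definition contains_pattern :: "nat list \<Rightarrow> nat list \<Rightarrow> bool" where
  "contains_pattern xs p \<longleftrightarrow>
     (\<exists>is. length is = length p \<and> sorted_wrt (<) is \<and> (\<forall>k<length is. is ! k < length xs) \<and>
        (\<forall>a<length p. \<forall>b<length p. (xs ! (is ! a) < xs ! (is ! b) \<longleftrightarrow> p ! a < p ! b)))"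

definition avoiding :: "nat \<Rightarrow> nat list \<Rightarrow> nat list set" where
  "avoiding n p = {xs \<in> Sn n. \<not> contains_pattern xs p}"

definition pos :: "nat list \<Rightarrow> nat \<Rightarrow> nat" where
  "pos xs x = (THE i. 1 \<le> i \<and> i \<le> length xs \<and> rho xs i = x)"

definition desc_top :: "nat list \<Rightarrow> nat \<Rightarrow> bool" where
  "desc_top xs x \<longleftrightarrow> pos xs x \<le> length xs - 1 \<and> rho xs (pos xs x) > rho xs (pos xs x + 1)"

definition desc_bot :: "nat list \<Rightarrow> nat \<Rightarrow> bool" where
  "desc_bot xs x \<longleftrightarrow> 2 \<le> pos xs x \<and> rho xs (pos xs x - 1) > rho xs (pos xs x)"

definition cstat :: "nat list \<Rightarrow> nat \<Rightarrow> nat" where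
  "cstat xs x = card {j. pos xs x < j \<and> j < length xs \<and> rho xs (j + 1) < x \<and> x < rho xs j}"

definition fw :: "nat list \<Rightarrow> nat list" where
  "fw xs = sorted_list_of_set {x \<in> set xs. desc_bot xs x}"

definition gw :: "nat list \<Rightarrow> nat list" where
  "gw xs = sorted_list_of_set {x \<in> set xs. \<not> desc_bot xs x}"

definition fw' :: "nat list \<Rightarrow> nat list" where
  "fw' xs = (THE w. distinct w \<and> set w = {x \<in> set xs. desc_top xs x} \<and>
      (\<forall>k<length w. card {l. l < k \<and> w ! l > w ! k} = cstat xs (w ! k)))"

definition gw' :: "nat list \<Rightarrow> nat list" where
  "gw' xs = (THE w. distinct w \<and> set w = {x \<in> set xs. \<not> desc_top xs x} \<and>
      (\<forall>k<length w. card {l. k < l \<and> l < length w \<and> w ! l < w ! k} = cstat xs (w ! k)))"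

text \<open>Phi: tau(b) = a for each column (top a, bottom b) of the array fg / f'g'.\<close>
definition Phi :: "nat list \<Rightarrow> nat list" where
  "Phi xs = map (\<lambda>b. the (map_of (zip (fw' xs @ gw' xs) (fw xs @ gw xs)) b)) [1..<length xs + 1]"

definition Psi :: "nat list \<Rightarrow> nat list" where
  "Psi sigma = tl (Phi (map Suc sigma @ [1]))"

end

theory Submission
  imports Defs
begin

text \<open>
  Let \<open>\<rho>\<close> be \<open>\<sigma> + 1\<close> followed by 1, with set \<open>D\<close> of descent tops and set \<open>B\<close> of
  descent bottoms. If \<open>\<rho>\<close> avoids 213, then to the right of any letter all larger letters precede
  all smaller ones, so \<open>c\<close> vanishes on \<open>D\<close> and at the last letter 1 and equals 1 at every other
  letter. Hence \<open>\<Phi>(\<rho>)\<close> maps 1 to \<open>n + 1\<close> and is increasing both from \<open>D\<close> onto \<open>B\<close> and from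
  \<open>{2..n+1} - D\<close> onto \<open>{1..n} - B\<close>, so \<open>\<Psi>(\<sigma>)\<close> avoids 321. For \<open>2 \<le> y \<le> n + 1\<close> the word \<open>\<rho>\<close> ends
  below \<open>y\<close>, so \<open>D\<close> has more elements \<open>\<ge> y\<close> than \<open>B\<close>; this forces \<open>D\<close> to be exactly the set of
  positions \<open>b \<ge> 2\<close> with \<open>\<Phi>(\<rho>)(b) < b\<close>. Thus \<open>\<Psi>(\<sigma>)\<close> and the pair \<open>(D, B)\<close> determine each other.
  A pigeonhole argument shows that every 321-avoiding permutation arises in this way from a pair
  satisfying the counting inequality. It remains to see that a 213-avoiding \<open>\<rho>\<close> ending in 1 is
  determined by \<open>(D, B)\<close> (compare two candidates at the last place where they differ) and that every
  pair satisfying the counting inequality occurs.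
\<close>

section \<open>Pattern avoidance, descent tops and descent bottoms\<close>

definition avoids213 :: "'a::linorder list \<Rightarrow> bool" where
  "avoids213 xs \<longleftrightarrow> (\<forall>i j k. i < j \<longrightarrow> j < k \<longrightarrow> k < length xs \<longrightarrow> \<not> (xs ! j < xs ! i \<and> xs ! i < xs ! k))"

definition avoids321 :: "'a::linorder list \<Rightarrow> bool" where
  "avoids321 xs \<longleftrightarrow> (\<forall>i j k. i < j \<longrightarrow> j < k \<longrightarrow> k < length xs \<longrightarrow> \<not> (xs ! k < xs ! j \<and> xs ! j < xs ! i))"

lemma avoids213D:
  "\<lbrakk>avoids213 xs; i < j; j < k; k < length xs; xs ! j < xs ! i; xs ! i < xs ! k\<rbrakk> \<Longrightarrow> False"
  by (auto simp: avoids213_def)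

lemma avoids321D:
  "\<lbrakk>avoids321 xs; i < j; j < k; k < length xs; xs ! k < xs ! j; xs ! j < xs ! i\<rbrakk> \<Longrightarrow> False"
  by (auto simp: avoids321_def)

lemma contains_pattern_length3:
  "contains_pattern xs [a, b, c] \<longleftrightarrow>
     (\<exists>i j k. i < j \<and> j < k \<and> k < length xs \<and>
        (xs ! i < xs ! j \<longleftrightarrow> a < b) \<and> (xs ! j < xs ! i \<longleftrightarrow> b < a) \<and>
        (xs ! i < xs ! k \<longleftrightarrow> a < c) \<and> (xs ! k < xs ! i \<longleftrightarrow> c < a) \<and>
        (xs ! j < xs ! k \<longleftrightarrow> b < c) \<and> (xs ! k < xs ! j \<longleftrightarrow> c < b))" (is "?L \<longleftrightarrow> ?R")
proof
  assume ?L
  then obtain "is" where l: "length is = 3" and s: "sorted_wrt (<) is"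
    and b: "\<forall>k<3. is ! k < length xs"
    and p: "\<forall>u<3. \<forall>v<3. (xs ! (is ! u) < xs ! (is ! v) \<longleftrightarrow> [a,b,c] ! u < [a,b,c] ! v)"
    by (auto simp: contains_pattern_def numeral_3_eq_3)
  have s': "is ! 0 < is ! 1" "is ! 1 < is ! 2"
    using l s by (auto simp: sorted_wrt_iff_nth_less)
  show ?R
    apply (rule exI[of _ "is ! 0"], rule exI[of _ "is ! 1"], rule exI[of _ "is ! 2"])
    using s' b p[rule_format, of 0 1] p[rule_format, of 1 0] p[rule_format, of 0 2]
      p[rule_format, of 2 0] p[rule_format, of 1 2] p[rule_format, of 2 1] by simp
next
  assume ?R
  then obtain i j k where *: "i < j" "j < k" "k < length xs"
        "(xs ! i < xs ! j \<longleftrightarrow> a < b)" "(xs ! j < xs ! i \<longleftrightarrow> b < a)"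
        "(xs ! i < xs ! k \<longleftrightarrow> a < c)" "(xs ! k < xs ! i \<longleftrightarrow> c < a)"
        "(xs ! j < xs ! k \<longleftrightarrow> b < c)" "(xs ! k < xs ! j \<longleftrightarrow> c < b)" by blast
  show ?L unfolding contains_pattern_def
    apply (rule exI[of _ "[i, j, k]"])
    using * by (auto simp: less_Suc_eq)
qed

lemma avoiding_213: "xs \<in> avoiding n [2,1,3] \<longleftrightarrow> distinct xs \<and> set xs = {1..n} \<and> avoids213 xs"
proof -
  have "contains_pattern xs [2,1,3] \<longleftrightarrow> \<not> avoids213 xs"
  proof -
    have "\<not> avoids213 xs \<longleftrightarrow> (\<exists>i j k. i < j \<and> j < k \<and> k < length xs \<and> xs ! j < xs ! i \<and> xs ! i < xs ! k)"
      by (auto simp: avoids213_def)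
    then show ?thesis unfolding contains_pattern_length3
      by (simp only:) (intro iff_exI, auto)
  qed
  then show ?thesis by (auto simp: avoiding_def Sn_def permutations_of_set_def)
qed

lemma avoiding_321: "xs \<in> avoiding n [3,2,1] \<longleftrightarrow> distinct xs \<and> set xs = {1..n} \<and> avoids321 xs"
proof -
  have "contains_pattern xs [3,2,1] \<longleftrightarrow> \<not> avoids321 xs"
  proof -
    have "\<not> avoids321 xs \<longleftrightarrow> (\<exists>i j k. i < j \<and> j < k \<and> k < length xs \<and> xs ! k < xs ! j \<and> xs ! j < xs ! i)"
      by (auto simp: avoids321_def)
    then show ?thesis unfolding contains_pattern_length3
      by (simp only:) (intro iff_exI, auto)
  qed
  then show ?thesis by (auto simp: avoiding_def Sn_def permutations_of_set_def)
qed

text \<open>Translates between two sorted rows of an array and an increasing bijection. Read from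
  right to left, it also shows that two increasing bijections between the same finite sets
  agree.\<close>

lemma map_sorted_list_of_set_eq_iff:
  fixes p :: "'a::linorder \<Rightarrow> 'b::linorder"
  assumes "finite A" "finite C"
  shows "map p (sorted_list_of_set A) = sorted_list_of_set C \<longleftrightarrow> strict_mono_on A p \<and> p ` A = C"
    (is "?L \<longleftrightarrow> ?R")
proof
  assume L: ?L
  then have "p ` A = C" using assms by (metis list.set_map set_sorted_list_of_set)
  moreover have "strict_mono_on A p"
  proof (rule strict_mono_onI)
    fix x y assume xy: "x \<in> A" "y \<in> A" "x < y"
    let ?l = "sorted_list_of_set A"
    obtain i j where ij: "i < length ?l" "j < length ?l" "?l ! i = x" "?l ! j = y"
      using xy assms by (metis in_set_conv_nth set_sorted_list_of_set)
    have "i < j"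
      using ij xy sorted_nth_mono[OF sorted_sorted_list_of_set, of j i A] by (metis leD leI)
    moreover have "sorted_wrt (<) (map p ?l)" using L by simp
    ultimately show "p x < p y" using ij
      by (auto simp: sorted_wrt_map sorted_wrt_iff_nth_less)
  qed
  ultimately show ?R by simp
next
  assume R: ?R
  have "sorted_wrt (\<lambda>x y. p x < p y) (sorted_list_of_set A)"
    by (rule sorted_wrt_mono_rel[OF _ strict_sorted_list_of_set])
      (use R assms in \<open>auto simp: strict_mono_on_def\<close>)
  then have "sorted_wrt (<) (map p (sorted_list_of_set A))" by (simp add: sorted_wrt_map)
  moreover have "set (map p (sorted_list_of_set A)) = C" using R assms by simp
  ultimately show ?L
    by (metis strict_sorted_equal strict_sorted_list_of_set assms(2) set_sorted_list_of_set)
qed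

lemma map_the_map_of_zip:
  assumes "distinct ks" "length ks = length vs"
  shows "map (\<lambda>b. the (map_of (zip ks vs) b)) ks = vs"
  using assms by (intro nth_equalityI) (auto simp: map_of_zip_nth)

section \<open>Descent tops and descent bottoms as sets of letters\<close>

definition dtops :: "'a::linorder list \<Rightarrow> 'a set" where
  "dtops xs = {xs ! i | i. Suc i < length xs \<and> xs ! Suc i < xs ! i}"

definition dbots :: "'a::linorder list \<Rightarrow> 'a set" where
  "dbots xs = {xs ! Suc i | i. Suc i < length xs \<and> xs ! Suc i < xs ! i}"

lemma pos_nth: "distinct xs \<Longrightarrow> i < length xs \<Longrightarrow> pos xs (xs ! i) = Suc i"
  unfolding pos_def rho_def
  by (rule the_equality) (auto simp: nth_eq_iff_index_eq)

lemma nth_in_dtops: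
  assumes "distinct xs" "i < length xs"
  shows "xs ! i \<in> dtops xs \<longleftrightarrow> Suc i < length xs \<and> xs ! Suc i < xs ! i"
proof
  assume "xs ! i \<in> dtops xs"
  then obtain j where j: "xs ! i = xs ! j" "Suc j < length xs" "xs ! Suc j < xs ! j"
    by (auto simp: dtops_def)
  then have "i = j" using assms nth_eq_iff_index_eq[OF assms(1), of i j] by simp
  then show "Suc i < length xs \<and> xs ! Suc i < xs ! i" using j by simp
qed (auto simp: dtops_def)

lemma nth_Suc_in_dbots:
  assumes "distinct xs" "Suc i < length xs"
  shows "xs ! Suc i \<in> dbots xs \<longleftrightarrow> xs ! Suc i < xs ! i"
  using assms nth_eq_iff_index_eq[OF assms(1)] unfolding dbots_def by auto

lemma nth_0_notin_dbots:
  assumes "distinct xs"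
  shows "xs ! 0 \<notin> dbots xs"
proof (cases "xs = []")
  case True then show ?thesis by (simp add: dbots_def)
next
  case False
  then show ?thesis using nth_eq_iff_index_eq[OF assms, of 0] unfolding dbots_def by auto
qed

lemma desc_top_iff:
  assumes "distinct xs" "x \<in> set xs"
  shows "desc_top xs x \<longleftrightarrow> x \<in> dtops xs"
proof -
  obtain i where i: "i < length xs" "x = xs ! i" using assms by (metis in_set_conv_nth)
  then show ?thesis
    using assms by (auto simp: desc_top_def pos_nth nth_in_dtops rho_def)
qed

lemma desc_bot_iff:
  assumes "distinct xs" "x \<in> set xs"
  shows "desc_bot xs x \<longleftrightarrow> x \<in> dbots xs"
proof -
  obtain i where i: "i < length xs" "x = xs ! i" using assms by (metis in_set_conv_nth)
  then show ?thesis
    using assms nth_0_notin_dbots[OF assms(1)]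
    by (cases i) (auto simp: desc_bot_def pos_nth nth_Suc_in_dbots rho_def)
qed

lemma dtops_subset: "dtops xs \<subseteq> set xs" by (auto simp: dtops_def)
lemma dbots_subset: "dbots xs \<subseteq> set xs" by (auto simp: dbots_def)

lemma finite_dtops [simp]: "finite (dtops xs)" by (rule finite_subset[OF dtops_subset]) simp
lemma finite_dbots [simp]: "finite (dbots xs)" by (rule finite_subset[OF dbots_subset]) simp

text \<open>Tops and bottoms are both counted by the index of their descent, so that the two counts
  can be compared by inclusion of index sets.\<close>

lemma card_dtops_ge:
  assumes "distinct xs"
  shows "card {x \<in> dtops xs. y \<le> x} = card {i. Suc i < length xs \<and> xs ! Suc i < xs ! i \<and> y \<le> xs ! i}"
proof -
  have "{x \<in> dtops xs. y \<le> x} = (!) xs ` {i. Suc i < length xs \<and> xs ! Suc i < xs ! i \<and> y \<le> xs ! i}"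
    by (auto simp: dtops_def)
  moreover have "inj_on ((!) xs) {i. Suc i < length xs \<and> xs ! Suc i < xs ! i \<and> y \<le> xs ! i}"
    using assms by (auto simp: inj_on_def nth_eq_iff_index_eq)
  ultimately show ?thesis by (simp add: card_image)
qed

lemma card_dbots_ge:
  assumes "distinct xs"
  shows "card {x \<in> dbots xs. y \<le> x} = card {i. Suc i < length xs \<and> xs ! Suc i < xs ! i \<and> y \<le> xs ! Suc i}"
proof -
  have "{x \<in> dbots xs. y \<le> x} = (\<lambda>i. xs ! Suc i) ` {i. Suc i < length xs \<and> xs ! Suc i < xs ! i \<and> y \<le> xs ! Suc i}"
    by (auto simp: dbots_def)
  moreover have "inj_on (\<lambda>i. xs ! Suc i) {i. Suc i < length xs \<and> xs ! Suc i < xs ! i \<and> y \<le> xs ! Suc i}"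
    using assms by (auto simp: inj_on_def nth_eq_iff_index_eq)
  ultimately show ?thesis by (simp add: card_image)
qed

section \<open>The image of a 213-avoiding permutation\<close>

text \<open>An intrinsic description of the words \<open>map Suc s @ [1]\<close> with
  \<open>s\<close> avoiding 213. It allows words to be built or compared by their descent sets
  before any \<open>s\<close> is extracted.\<close>

locale hat_perm =
  fixes n :: nat and xs :: "nat list"
  assumes dist: "distinct xs" and set_xs: "set xs = {1..Suc n}" and last_xs: "last xs = 1"
    and av: "avoids213 xs"
begin

lemma length_xs: "length xs = Suc n"
  using distinct_card[OF dist] set_xs by simp

lemma nth_n: "xs ! n = 1"
  using last_xs length_xs by (metis diff_Suc_1 last_conv_nth length_0_conv nat.distinct(1))

lemma nth_ge: "i \<le> n \<Longrightarrow> 1 \<le> xs ! i"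
  using set_xs length_xs nth_mem[of i xs] by auto

lemma nth_gt: "i < n \<Longrightarrow> 1 < xs ! i"
  using nth_ge[of i] nth_n dist length_xs nth_eq_iff_index_eq[OF dist, of i n] by auto

lemma ex_nth: "x \<in> {1..Suc n} \<Longrightarrow> \<exists>i\<le>n. x = xs ! i"
  using set_xs length_xs by (metis in_set_conv_nth less_Suc_eq_le)

lemma one_notin_dtops: "1 \<notin> dtops xs"
  using nth_in_dtops[OF dist, of n] length_xs nth_n by simp

lemma dtops_sub: "dtops xs \<subseteq> {2..Suc n}"
proof
  fix x assume x: "x \<in> dtops xs"
  then have "x \<in> {1..Suc n}" "x \<noteq> 1" using dtops_subset[of xs] set_xs one_notin_dtops by auto
  then show "x \<in> {2..Suc n}" by auto
qed

lemma dbots_sub: "dbots xs \<subseteq> {1..n}"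
proof
  fix x assume x: "x \<in> dbots xs"
  then obtain i where i: "Suc i < length xs" "xs ! Suc i < xs ! i" "x = xs ! Suc i"
    by (auto simp: dbots_def)
  have "xs ! i \<in> {1..Suc n}" "xs ! Suc i \<in> {1..Suc n}" using set_xs i by (metis nth_mem Suc_lessD)+
  then show "x \<in> {1..n}" using i by auto
qed

text \<open>A descent whose bottom is at least \<open>y\<close> also has its top at least
  \<open>y\<close>. Since the word ends in 1, it must finally drop below \<open>y\<close>, and that
  descent contributes a top only.\<close>

lemma card_less:
  assumes y: "2 \<le> y" "y \<le> Suc n"
  shows "card {x \<in> dbots xs. y \<le> x} < card {x \<in> dtops xs. y \<le> x}"
proof -
  obtain i0 where i0: "i0 \<le> n" "y = xs ! i0" using ex_nth[of y] y by auto
  \<comment> \<open>The last index carrying a letter at least \<open>y\<close>; its successor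
    carries a letter below \<open>y\<close>.\<close>
  define i where "i = Max {i. i \<le> n \<and> y \<le> xs ! i}"
  have fin: "finite {i. i \<le> n \<and> y \<le> xs ! i}" by simp
  have "i \<in> {i. i \<le> n \<and> y \<le> xs ! i}"
    unfolding i_def by (rule Max_in[OF fin]) (use i0 in auto)
  then have i: "i \<le> n" "y \<le> xs ! i" by auto
  have "i \<noteq> n" using i nth_n y by auto
  then have "i < n" using i by simp
  have "\<not> y \<le> xs ! Suc i"
  proof
    assume "y \<le> xs ! Suc i"
    then have "Suc i \<le> i" using Max_ge[OF fin, of "Suc i"] \<open>i < n\<close> unfolding i_def by auto
    then show False by simp
  qed
  have "{i. Suc i < length xs \<and> xs ! Suc i < xs ! i \<and> y \<le> xs ! Suc i} \<subset>
     {i. Suc i < length xs \<and> xs ! Suc i < xs ! i \<and> y \<le> xs ! i}"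
    (is "?B \<subset> ?A")
  proof (intro psubsetI)
    show "?B \<subseteq> ?A" by auto
    have "i \<in> ?A" "i \<notin> ?B" using i \<open>i < n\<close> length_xs \<open>\<not> y \<le> xs ! Suc i\<close> by auto
    then show "?B \<noteq> ?A" by blast
  qed
  moreover have "finite {i. Suc i < length xs \<and> xs ! Suc i < xs ! i \<and> y \<le> xs ! i}"
    by (rule finite_subset[of _ "{..<length xs}"]) auto
  ultimately show ?thesis
    unfolding card_dtops_ge[OF dist] card_dbots_ge[OF dist] by (rule psubset_card_mono[rotated])
qed

lemma card_eq: "card (dtops xs) = card (dbots xs)"
  using card_dtops_ge[OF dist, of 0] card_dbots_ge[OF dist, of 0] by simp

section \<open>The statistic c on a 213-avoiding word\<close>

lemma cstat_nth:
  assumes "i \<le> n"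
  shows "cstat xs (xs ! i) = card {j. Suc i < j \<and> j \<le> n \<and> xs ! j < xs ! i \<and> xs ! i < xs ! (j - 1)}"
  unfolding cstat_def using assms length_xs
  by (simp add: pos_nth[OF dist] rho_def less_Suc_eq_le)

text \<open>A drop past \<open>x\<close> further right would supply a letter above \<open>x\<close>
  which, together with \<open>x\<close> and the smaller letter right after it, forms a 213.\<close>

lemma cstat_dtop:
  assumes "x \<in> dtops xs"
  shows "cstat xs x = 0"
proof -
  obtain i where i: "Suc i < length xs" "xs ! Suc i < xs ! i" "x = xs ! i"
    using assms by (auto simp: dtops_def)
  have "\<not> (Suc i < j \<and> j \<le> n \<and> xs ! j < xs ! i \<and> xs ! i < xs ! (j - 1))" for j
  proof
    assume j: "Suc i < j \<and> j \<le> n \<and> xs ! j < xs ! i \<and> xs ! i < xs ! (j - 1)"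
    then have "j - 1 \<noteq> Suc i" using i by (metis not_less_iff_gr_or_eq)
    then show False using j i length_xs by (intro avoids213D[OF av, of i "Suc i" "j - 1"]) auto
  qed
  then have "{j. Suc i < j \<and> j \<le> n \<and> xs ! j < xs ! i \<and> xs ! i < xs ! (j - 1)} = {}" by blast
  moreover have "i \<le> n" using i length_xs by simp
  ultimately show ?thesis using i by (simp only: cstat_nth card.empty)
qed

lemma cstat_one: "cstat xs 1 = 0"
  using cstat_nth[of n] nth_n by simp

text \<open>The letter after \<open>x\<close> is larger and the last letter 1 is smaller, so the
  word crosses the level \<open>x\<close> downwards at least once. A second downward crossing would
  need a letter above \<open>x\<close> after a letter below \<open>x\<close>, which is a
  213.\<close>

lemma cstat_nondtop:
  assumes "x \<in> {2..Suc n} - dtops xs"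
  shows "cstat xs x = 1"
proof -
  obtain i where i: "i \<le> n" "x = xs ! i" using assms ex_nth[of x] by auto
  have "i < n" using i assms nth_n by (cases "i = n") auto
  then have up: "xs ! i < xs ! Suc i"
    using assms i nth_in_dtops[OF dist, of i] length_xs nth_eq_iff_index_eq[OF dist, of i "Suc i"]
    by (metis DiffD2 Suc_less_eq less_Suc_eq linorder_neqE_nat n_not_Suc_n)
  \<comment> \<open>The first later index with a letter below \<open>x\<close>. By minimality the
    letter just before it is above \<open>x\<close>, so this is the unique crossing.\<close>
  define j where "j = (LEAST j. i < j \<and> xs ! j < xs ! i)"
  have ex: "i < n \<and> xs ! n < xs ! i" using \<open>i < n\<close> nth_n nth_gt by simp
  then have j: "i < j" "xs ! j < xs ! i" unfolding j_def by (metis (mono_tags, lifting) LeastI)+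
  have "j \<le> n" using ex unfolding j_def by (rule Least_le)
  have "j \<noteq> Suc i" using up j by auto
  have "\<not> (i < j - 1 \<and> xs ! (j - 1) < xs ! i)"
    using not_less_Least[of "j - 1" "\<lambda>j. i < j \<and> xs ! j < xs ! i"] j unfolding j_def[symmetric] by auto
  then have "xs ! i < xs ! (j - 1)"
    using \<open>j \<noteq> Suc i\<close> j less_imp_diff_less[of j "Suc n" 1] \<open>j \<le> n\<close> \<open>i \<le> n\<close>
      nth_eq_iff_index_eq[OF dist, of i "j - 1"] length_xs
    by (cases "xs ! i = xs ! (j - 1)") (auto simp: not_less_iff_gr_or_eq)
  have "{j. Suc i < j \<and> j \<le> n \<and> xs ! j < xs ! i \<and> xs ! i < xs ! (j - 1)} = {j}"
  proof (intro equalityI subsetI)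
    fix k assume k: "k \<in> {j. Suc i < j \<and> j \<le> n \<and> xs ! j < xs ! i \<and> xs ! i < xs ! (j - 1)}"
    have "j \<le> k" unfolding j_def by (rule Least_le) (use k in auto)
    moreover have "\<not> j < k"
    proof
      assume "j < k"
      moreover have "j \<noteq> k - 1" using k j by (metis (mono_tags, lifting) mem_Collect_eq not_less_iff_gr_or_eq)
      ultimately show False
        using k j length_xs by (intro avoids213D[OF av, of i j "k - 1"]) auto
    qed
    ultimately show "k \<in> {j}" by simp
  qed (use j \<open>j \<le> n\<close> \<open>j \<noteq> Suc i\<close> \<open>xs ! i < xs ! (j - 1)\<close> in auto)
  then show ?thesis using cstat_nth[OF i(1)] i by simp
qed

section \<open>The rows of the two-row array\<close>

lemma fw_eq: "fw xs = sorted_list_of_set (dbots xs)"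
proof -
  have "{x \<in> set xs. desc_bot xs x} = dbots xs"
    using desc_bot_iff[OF dist] dbots_subset[of xs] by auto
  then show ?thesis by (simp add: fw_def)
qed

text \<open>The maximal letter \<open>Suc n\<close> is never a descent bottom. It is split off
  because it ends the top row, above the final 1 of the bottom row.\<close>

lemma gw_eq: "gw xs = sorted_list_of_set ({1..n} - dbots xs) @ [Suc n]"
proof -
  have "{x \<in> set xs. \<not> desc_bot xs x} = insert (Suc n) ({1..n} - dbots xs)"
    using desc_bot_iff[OF dist] dbots_sub set_xs by auto
  moreover have "sorted_list_of_set (insert (Suc n) ({1..n} - dbots xs)) =
     sorted_list_of_set ({1..n} - dbots xs) @ [Suc n]"
    by (rule sorted_list_of_set_unique[THEN iffD1])
      (auto simp: sorted_wrt_append less_Suc_eq_le)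
  ultimately show ?thesis by (simp add: gw_def)
qed

text \<open>As c vanishes on descent tops, the defining condition says that no letter has a larger
  one to its left. This settles both existence and uniqueness for the definite description.\<close>

lemma fw'_eq: "fw' xs = sorted_list_of_set (dtops xs)"
proof -
  have D: "{x \<in> set xs. desc_top xs x} = dtops xs"
    using desc_top_iff[OF dist] dtops_subset[of xs] by auto
  have iff: "(\<forall>k<length w. card {l. l < k \<and> w ! l > w ! k} = cstat xs (w ! k)) \<longleftrightarrow> sorted w"
    if w: "set w = dtops xs" for w
  proof -
    have "(\<forall>k<length w. card {l. l < k \<and> w ! l > w ! k} = cstat xs (w ! k)) \<longleftrightarrow>
        (\<forall>k<length w. card {l. l < k \<and> w ! l > w ! k} = 0)"
      using w cstat_dtop nth_mem[of _ w] by auto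
    also have "\<dots> \<longleftrightarrow> (\<forall>k<length w. \<forall>l<k. w ! l \<le> w ! k)"
    proof -
      have "card {l. l < k \<and> w ! l > w ! k} = 0 \<longleftrightarrow> (\<forall>l<k. w ! l \<le> w ! k)" for k
        by (auto simp: card_eq_0_iff not_less) (meson not_less)+
      then show ?thesis by simp
    qed
    also have "\<dots> \<longleftrightarrow> sorted w" by (auto simp: sorted_wrt_iff_nth_less)
    finally show ?thesis .
  qed
  show ?thesis unfolding fw'_def D
  proof (rule the_equality)
    show "distinct (sorted_list_of_set (dtops xs)) \<and> set (sorted_list_of_set (dtops xs)) = dtops xs \<and>
       (\<forall>k<length (sorted_list_of_set (dtops xs)).
          card {l. l < k \<and> sorted_list_of_set (dtops xs) ! k < sorted_list_of_set (dtops xs) ! l} =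
            cstat xs (sorted_list_of_set (dtops xs) ! k))"
      by (subst iff) auto
  next
    fix w assume "distinct w \<and> set w = dtops xs \<and>
       (\<forall>k<length w. card {l. l < k \<and> w ! l > w ! k} = cstat xs (w ! k))"
    then show "w = sorted_list_of_set (dtops xs)"
      using iff[of w] by (metis sorted_list_of_set.idem_if_sorted_distinct)
  qed
qed

text \<open>Every letter except 1 must have exactly one smaller letter to its right. The final
  letter has none, so it is 1, and this 1 already is the smaller letter allowed to each of the
  others, which must therefore increase.\<close>

lemma gw'_eq: "gw' xs = sorted_list_of_set ({2..Suc n} - dtops xs) @ [1]"
proof -
  let ?T = "{2..Suc n} - dtops xs"
  let ?P = "\<lambda>w. distinct w \<and> set w = insert 1 ?T \<and>
       (\<forall>k<length w. card {l. k < l \<and> l < length w \<and> w ! l < w ! k} = cstat xs (w ! k))"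
  have D: "{x \<in> set xs. \<not> desc_top xs x} = insert 1 ?T"
    using desc_top_iff[OF dist] one_notin_dtops set_xs by auto
  have c: "cstat xs x = (if x = 1 then 0 else 1)" if "x \<in> insert 1 ?T" for x
    using that cstat_one cstat_nondtop[of x] by auto
  show ?thesis unfolding gw'_def D
  proof (rule the_equality)
    let ?s = "sorted_list_of_set ?T" let ?w = "?s @ [1]"
    have set_w: "set ?w = insert 1 ?T" by auto
    have "card {l. k < l \<and> l < length ?w \<and> ?w ! l < ?w ! k} = cstat xs (?w ! k)" if k: "k < length ?w" for k
    proof (cases "k < length ?s")
      case True
      have "?s ! k \<in> ?T" using True nth_mem[of k ?s] by simp
      moreover have "{l. k < l \<and> l < length ?w \<and> ?w ! l < ?w ! k} = {length ?s}"
      proof -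
        have "?s ! k \<le> ?s ! l" if "k < l" "l < length ?s" for l
          using that by (simp add: sorted_nth_mono)
        then show ?thesis
          using True \<open>?s ! k \<in> ?T\<close> by (force simp: nth_append not_less less_Suc_eq)
      qed
      ultimately show ?thesis using True cstat_nondtop[of "?s ! k"] by (simp add: nth_append)
    next
      case False
      then have k: "k = length ?s" using k by simp
      have "{l. k < l \<and> l < length ?w \<and> ?w ! l < ?w ! k} = {}" unfolding k by auto
      moreover have "?w ! k = 1" unfolding k by (rule nth_append_length)
      ultimately show ?thesis using cstat_one by (simp only: card.empty)
    qed
    then show "?P ?w" by (intro conjI allI impI set_w) auto
  next
    fix w assume w: "?P w"
    then have "w \<noteq> []" by auto
    then obtain u a where ua: "w = u @ [a]" by (metis rev_exhaust)
    have cw: "card {l. k < l \<and> l < length w \<and> w ! l < w ! k} = (if w ! k = 1 then 0 else 1)"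
      if "k < length w" for k
      using that w c[of "w ! k"] nth_mem[of k w] by auto
    have empty: "{l. length u < l \<and> l < length w \<and> w ! l < w ! length u} = {}" using ua by auto
    have "a = 1"
      using cw[of "length u"] unfolding empty by (simp add: ua split: if_splits)
    have "insert 1 (set u) = insert 1 ?T" "1 \<notin> set u" using w ua \<open>a = 1\<close> by simp_all
    then have setu: "set u = ?T" by (simp add: insert_ident)
    have "u ! i \<le> u ! j" if ij: "i < j" "j < length u" for i j
    proof (rule ccontr)
      assume "\<not> u ! i \<le> u ! j"
      \<comment> \<open>An inversion inside \<open>u\<close> would give \<open>u ! i\<close> two
        smaller letters to its right: \<open>u ! j\<close> and the final 1.\<close>
      then have "{j, length u} \<subseteq> {l. i < l \<and> l < length w \<and> w ! l < w ! i}"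
        using ij ua \<open>a = 1\<close> setu nth_mem[of i u] by (auto simp: nth_append)
      then have "card {j, length u} \<le> card {l. i < l \<and> l < length w \<and> w ! l < w ! i}"
        by (intro card_mono) auto
      also have "\<dots> \<le> 1" using cw[of i] ij ua by simp
      finally show False using ij by simp
    qed
    then have "sorted u" by (simp add: sorted_wrt_iff_nth_less)
    then have "u = sorted_list_of_set ?T"
      using setu w ua by (metis distinct_append sorted_list_of_set.idem_if_sorted_distinct)
    then show "w = sorted_list_of_set ?T @ [1]" using ua \<open>a = 1\<close> by simp
  qed
qed

text \<open>Here \<open>p b\<close> is the value of \<open>Phi xs\<close> at the position
  \<open>b\<close>: one unit of the shift by 2 comes from \<open>tl\<close>, the other from counting
  indices from 0. The last column of the array sends 1 to \<open>Suc n\<close>, and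
  \<open>tl\<close> removes exactly this value.\<close>

lemma tl_Phi:
  defines "p \<equiv> \<lambda>b. tl (Phi xs) ! (b - 2)"
  shows "length (tl (Phi xs)) = n"
    and "strict_mono_on (dtops xs) p" "p ` dtops xs = dbots xs"
    and "strict_mono_on ({2..Suc n} - dtops xs) p" "p ` ({2..Suc n} - dtops xs) = {1..n} - dbots xs"
proof -
  let ?sl = sorted_list_of_set
  let ?ks = "?sl (dtops xs) @ ?sl ({2..Suc n} - dtops xs) @ [1]"
  let ?vs = "?sl (dbots xs) @ ?sl ({1..n} - dbots xs) @ [Suc n]"
  define t where "t b = the (map_of (zip ?ks ?vs) b)" for b
  have Phi: "Phi xs = map t [1..<Suc (Suc n)]"
    unfolding Phi_def t_def fw_eq gw_eq fw'_eq gw'_eq length_xs by simp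
  have tl: "tl (Phi xs) = map t [2..<Suc (Suc n)]"
    unfolding Phi by (subst upt_rec) (simp add: numeral_2_eq_2 del: upt_Suc)
  then show "length (tl (Phi xs)) = n" by (simp del: upt_Suc)
  have pt: "p b = t b" if "b \<in> {2..Suc n}" for b
  proof -
    have "2 \<le> b" using that by simp
    then obtain c where "b = 2 + c" using le_Suc_ex by blast
    then show ?thesis using that unfolding p_def tl by (simp del: upt_Suc)
  qed
  have dk: "distinct ?ks" using one_notin_dtops by auto
  have c1: "card ({2..Suc n} - dtops xs) = card ({1..n} - dbots xs)"
    using card_Diff_subset[OF finite_dtops dtops_sub] card_Diff_subset[OF finite_dbots dbots_sub] card_eq
    by simp
  have "map t ?ks = ?vs"
    unfolding t_def by (rule map_the_map_of_zip[OF dk]) (use c1 card_eq in simp)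
  then have t: "map t (?sl (dtops xs)) = ?sl (dbots xs)"
     "map t (?sl ({2..Suc n} - dtops xs)) = ?sl ({1..n} - dbots xs)"
    using card_eq c1 by auto
  have "map p (?sl (dtops xs)) = ?sl (dbots xs)"
    unfolding t(1)[symmetric] by (rule map_cong[OF refl], rule pt) (use dtops_sub in auto)
  then show "strict_mono_on (dtops xs) p" "p ` dtops xs = dbots xs"
    by (simp_all add: map_sorted_list_of_set_eq_iff)
  have "map p (?sl ({2..Suc n} - dtops xs)) = ?sl ({1..n} - dbots xs)"
    unfolding t(2)[symmetric] by (rule map_cong[OF refl], rule pt) auto
  then show "strict_mono_on ({2..Suc n} - dtops xs) p" "p ` ({2..Suc n} - dtops xs) = {1..n} - dbots xs"
    by (simp_all add: map_sorted_list_of_set_eq_iff)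
qed

text \<open>This recovers the descent tops from the image word. Both directions play the
  monotonicity of \<open>p\<close> on one of the two classes against the inequality
  \<open>card_less\<close>.\<close>

lemma tl_Phi_less_iff:
  assumes b: "b \<in> {2..Suc n}"
  shows "tl (Phi xs) ! (b - 2) < b \<longleftrightarrow> b \<in> dtops xs"
proof -
  define p where "p = (\<lambda>b. tl (Phi xs) ! (b - 2))"
  note p = tl_Phi(2-)[folded p_def]
  have cl: "card {x \<in> dbots xs. b \<le> x} < card {x \<in> dtops xs. b \<le> x}" using card_less b by auto
  have "p b < b \<longleftrightarrow> b \<in> dtops xs"
  proof
    assume D: "b \<in> dtops xs"
    show "p b < b"
    proof (rule ccontr)
      assume "\<not> p b < b"
      \<comment> \<open>By monotonicity all tops from \<open>b\<close> on would be sent injectively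
        to bottoms from \<open>b\<close> on, but there are fewer of these.\<close>
      then have "p ` {x \<in> dtops xs. b \<le> x} \<subseteq> {x \<in> dbots xs. b \<le> x}"
        using p(1,2) D by (auto simp: strict_mono_on_def le_less) (metis less_trans not_less_iff_gr_or_eq)+
      moreover have "inj_on p {x \<in> dtops xs. b \<le> x}"
        by (rule inj_on_subset[OF strict_mono_on_imp_inj_on[OF p(1)]]) auto
      ultimately have "card {x \<in> dtops xs. b \<le> x} \<le> card {x \<in> dbots xs. b \<le> x}"
        by (intro card_inj_on_le[of p]) auto
      then show False using cl by simp
    qed
  next
    assume pb: "p b < b"
    show "b \<in> dtops xs"
    proof (rule ccontr)
      assume D: "b \<notin> dtops xs"
      \<comment> \<open>By monotonicity all non-tops in \<open>{2..b}\<close> go to non-bottoms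
        below \<open>b\<close>. Both ambient sets have \<open>b - 1\<close> elements, and taking
        complements in \<open>card_less\<close> shows that there are too few non-bottoms.\<close>
      have "p ` ({2..b} - dtops xs) \<subseteq> {1..<b} - dbots xs"
      proof
        fix y assume "y \<in> p ` ({2..b} - dtops xs)"
        then obtain x where x: "x \<in> {2..b} - dtops xs" "y = p x" by auto
        have x': "x \<in> {2..Suc n} - dtops xs" "b \<in> {2..Suc n} - dtops xs" using x b D by auto
        then have "p x \<le> p b" using p(3) x by (cases "x = b") (auto simp: strict_mono_on_def less_imp_le)
        moreover have "p x \<in> {1..n} - dbots xs" using p(4) x' by blast
        ultimately show "y \<in> {1..<b} - dbots xs" using x pb by auto
      qed
      moreover have "inj_on p ({2..b} - dtops xs)"
        by (rule inj_on_subset[OF strict_mono_on_imp_inj_on[OF p(3)]]) (use b in auto)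
      ultimately have le: "card ({2..b} - dtops xs) \<le> card ({1..<b} - dbots xs)"
        by (metis card_inj_on_le finite_Diff finite_atLeastLessThan)
      have 1: "{2..b} - dtops xs = {2..b} - {x \<in> dtops xs. x < b}" using D by (auto simp: le_less)
      have 2: "{1..<b} - dbots xs = {1..<b} - {x \<in> dbots xs. x < b}" by auto
      have 3: "card ({2..b} - dtops xs) = (b - 1) - card {x \<in> dtops xs. x < b}"
        unfolding 1 by (subst card_Diff_subset) (use dtops_sub in auto)
      have 4: "card ({1..<b} - dbots xs) = (b - 1) - card {x \<in> dbots xs. x < b}"
        unfolding 2 by (subst card_Diff_subset) (use dbots_sub in auto)
      have "{x \<in> dbots xs. x < b} \<subseteq> {1..<b}" using dbots_sub by auto
      then have 5: "card {x \<in> dbots xs. x < b} \<le> b - 1"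
        using card_mono[of "{1..<b}"] by fastforce
      have split: "card A = card {x \<in> A. x < b} + card {x \<in> A. b \<le> x}" if "finite A" for A :: "nat set"
        using that by (subst card_Un_disjoint[symmetric]) (auto intro: arg_cong[of _ _ card])
      have "card {x \<in> dtops xs. x < b} < card {x \<in> dbots xs. x < b}"
        using split[OF finite_dtops[of xs]] split[OF finite_dbots[of xs]] card_eq cl by linarith
      then show False using le 5 unfolding 3 4 by linarith
    qed
  qed
  then show ?thesis by (simp add: p_def)
qed

text \<open>Among the three positions of a 321 two are both tops or both non-tops, and
  \<open>p\<close> increases on each of these classes.\<close>

lemma tl_Phi_avoiding: "tl (Phi xs) \<in> avoiding n [3,2,1]"
proof -
  let ?w = "tl (Phi xs)"
  define p where "p = (\<lambda>b. ?w ! (b - 2))"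
  note p = tl_Phi(2-)[folded p_def]
  have "p ` {2..Suc n} = p ` (dtops xs \<union> ({2..Suc n} - dtops xs))" using dtops_sub by (simp add: Un_absorb1)
  also have "\<dots> = {1..n}" unfolding image_Un p using dbots_sub by auto
  finally have im: "p ` {2..Suc n} = {1..n}" .
  have "(\<lambda>b. b - 2) ` {2..Suc n} = {..<n}"
    by (auto simp: image_iff intro!: bexI[of _ "_ + 2"])
  then have "p ` {2..Suc n} = (!) ?w ` {..<n}" unfolding p_def by (metis image_image)
  then have set: "set ?w = {1..n}" using im tl_Phi(1) by (auto simp: set_conv_nth)
  then have "distinct ?w" using tl_Phi(1) by (intro card_distinct) simp
  moreover have "avoids321 ?w" unfolding avoids321_def
  proof (intro allI impI notI)
    fix i j k assume *: "i < j" "j < k" "k < length ?w" "?w ! k < ?w ! j \<and> ?w ! j < ?w ! i"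
    define a b c where "a = i + 2" "b = j + 2" "c = k + 2"
    have abc: "a < b" "b < c" "a \<in> {2..Suc n}" "b \<in> {2..Suc n}" "c \<in> {2..Suc n}"
      "p c < p b" "p b < p a" using * tl_Phi(1) by (auto simp: a_b_c_def p_def)
    have mono: "p x < p y" if "x < y" "x \<in> {2..Suc n}" "y \<in> {2..Suc n}" "x \<in> dtops xs \<longleftrightarrow> y \<in> dtops xs" for x y
      using p(1,3) that by (cases "x \<in> dtops xs") (auto simp: strict_mono_on_def)
    show False using mono[of a b] mono[of b c] mono[of a c] abc by auto
  qed
  ultimately show ?thesis using set avoiding_321 by blast
qed

end

section \<open>Uniqueness for given descent sets\<close>

text \<open>At the last difference \<open>i\<close>, each word contains the other's letter at an
  earlier index. Whether the common next letter is a descent bottom decides which of the two words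
  contains a 213.\<close>

lemma hat_perm_eqI_aux:
  assumes "hat_perm n xs" "hat_perm n ys" and D: "dtops xs = dtops ys" and B: "dbots xs = dbots ys"
    and suf: "\<And>j. i < j \<Longrightarrow> j \<le> n \<Longrightarrow> xs ! j = ys ! j" and "i < n" and less: "xs ! i < ys ! i"
  shows False
proof -
  interpret X: hat_perm n xs by fact
  interpret Y: hat_perm n ys by fact
  note len = X.length_xs Y.length_xs
  have "ys ! i \<in> set xs" using X.set_xs Y.set_xs len \<open>i < n\<close> nth_mem[of i ys] by simp
  then obtain k where k: "k \<le> n" "xs ! k = ys ! i"
    by (metis in_set_conv_nth len(1) less_Suc_eq_le)
  have "\<not> i < k" using k suf[of k] nth_eq_iff_index_eq[OF Y.dist, of k i] len \<open>i < n\<close> by auto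
  then have "k < i" using k less by (metis less_irrefl linorder_neqE_nat)
  have "xs ! i \<in> set ys" using X.set_xs Y.set_xs len \<open>i < n\<close> nth_mem[of i xs] by simp
  then obtain l where l: "l \<le> n" "ys ! l = xs ! i"
    by (metis in_set_conv_nth len(2) less_Suc_eq_le)
  have "\<not> i < l" using l suf[of l] nth_eq_iff_index_eq[OF X.dist, of l i] len \<open>i < n\<close> by auto
  then have "l < i" using l less by (metis less_irrefl linorder_neqE_nat)
  have z: "xs ! Suc i = ys ! Suc i" using suf \<open>i < n\<close> by simp
  show False
  proof (cases "xs ! Suc i \<in> dbots xs")
    \<comment> \<open>Then \<open>xs ! i\<close> is a descent top in both words. In
      \<open>ys\<close> it stands at \<open>l\<close>, is followed by a smaller letter, and the
      larger \<open>ys ! i\<close> comes later.\<close>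
    case True
    then have "xs ! i \<in> dtops ys"
      using nth_Suc_in_dbots[OF X.dist, of i] nth_in_dtops[OF X.dist, of i] len \<open>i < n\<close> D by simp
    then have lt: "ys ! Suc l < ys ! l"
      using nth_in_dtops[OF Y.dist, of l] l len by simp
    then have "Suc l \<noteq> i" using less l by (metis less_asym)
    then show False
      using avoids213D[OF Y.av, of l "Suc l" i] lt \<open>l < i\<close> \<open>i < n\<close> len less l by simp
  next
    \<comment> \<open>Now \<open>ys ! i\<close> lies below the next letter. In \<open>xs\<close> the
      letters at \<open>k\<close>, \<open>i\<close> and \<open>Suc i\<close> form a 213.\<close>
    case False
    then have "\<not> ys ! Suc i < ys ! i"
      using nth_Suc_in_dbots[OF Y.dist, of i] len \<open>i < n\<close> B z by simp
    then have "ys ! i < xs ! Suc i"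
      using nth_eq_iff_index_eq[OF Y.dist, of i "Suc i"] len \<open>i < n\<close> z by (simp add: not_less le_less)
    then show False
      using avoids213D[OF X.av, of k i "Suc i"] \<open>k < i\<close> \<open>i < n\<close> len less k by simp
  qed
qed

lemma hat_perm_eqI:
  assumes "hat_perm n xs" "hat_perm n ys" "dtops xs = dtops ys" "dbots xs = dbots ys"
  shows "xs = ys"
proof (rule ccontr)
  assume "xs \<noteq> ys"
  interpret X: hat_perm n xs by fact
  interpret Y: hat_perm n ys by fact
  define I where "I = {i. i \<le> n \<and> xs ! i \<noteq> ys ! i}"
  have "finite I" unfolding I_def by simp
  have "I \<noteq> {}"
    using \<open>xs \<noteq> ys\<close> nth_equalityI[of xs ys] X.length_xs Y.length_xs
    by (auto simp: I_def less_Suc_eq_le)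
  define i where "i = Max I"
  have "i \<in> I" unfolding i_def by (rule Max_in) fact+
  then have i: "i < n" "xs ! i \<noteq> ys ! i"
    using X.nth_n Y.nth_n by (auto simp: I_def le_less)
  have suf: "xs ! j = ys ! j" if "i < j" "j \<le> n" for j
  proof (rule ccontr)
    assume "xs ! j \<noteq> ys ! j"
    then have "j \<le> i" unfolding i_def using \<open>finite I\<close> that by (intro Max_ge) (auto simp: I_def)
    then show False using that by simp
  qed
  from i(2) consider "xs ! i < ys ! i" | "ys ! i < xs ! i" by linarith
  then show False
    by cases (use hat_perm_eqI_aux[of n xs ys i] hat_perm_eqI_aux[of n ys xs i] assms suf i in auto)
qed

section \<open>Existence for given descent sets\<close>

lemma avoids213_append:
  assumes "avoids213 xs" "avoids213 ys" "\<And>x y. x \<in> set xs \<Longrightarrow> y \<in> set ys \<Longrightarrow> y < x"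
  shows "avoids213 (xs @ ys)"
  unfolding avoids213_def
proof (intro allI impI notI)
  fix i j k
  let ?l = "length xs"
  assume *: "i < j" "j < k" "k < length (xs @ ys)"
    "(xs @ ys) ! j < (xs @ ys) ! i \<and> (xs @ ys) ! i < (xs @ ys) ! k"
  consider "k < ?l" | "?l \<le> i" | "i < ?l" "?l \<le> k" by linarith
  then show False
  proof cases
    case 1
    then show False using * avoids213D[OF assms(1), of i j k] by (simp add: nth_append)
  next
    case 2
    then have "i - ?l < j - ?l" "j - ?l < k - ?l" "k - ?l < length ys" using * by auto
    then show False using 2 * avoids213D[OF assms(2), of "i - ?l" "j - ?l" "k - ?l"]
      by (simp add: nth_append)
  next
    case 3
    then have "(xs @ ys) ! k < (xs @ ys) ! i"
      using * assms(3)[of "xs ! i" "ys ! (k - ?l)"] by (simp add: nth_append)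
    then show False using * by (metis less_asym)
  qed
qed

lemma avoids213_appendD: "avoids213 (xs @ ys) \<Longrightarrow> avoids213 xs"
  unfolding avoids213_def
proof (intro allI impI)
  fix i j k
  assume *: "\<forall>i j k. i < j \<longrightarrow> j < k \<longrightarrow> k < length (xs @ ys) \<longrightarrow>
      \<not> ((xs @ ys) ! j < (xs @ ys) ! i \<and> (xs @ ys) ! i < (xs @ ys) ! k)"
    and ijk: "i < j" "j < k" "k < length xs"
  show "\<not> (xs ! j < xs ! i \<and> xs ! i < xs ! k)"
    using *[rule_format, of i j k] ijk by (simp add: nth_append)
qed

lemma avoids213_Cons:
  assumes "avoids213 xs" "\<And>x. x \<in> set xs \<Longrightarrow> y < x"
  shows "avoids213 (y # xs)"
  unfolding avoids213_def
proof (intro allI impI notI)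
  fix i j k
  assume *: "i < j" "j < k" "k < length (y # xs)"
    "(y # xs) ! j < (y # xs) ! i \<and> (y # xs) ! i < (y # xs) ! k"
  then obtain j' k' where jk: "j = Suc j'" "k = Suc k'" by (metis less_nat_zero_code not0_implies_Suc)
  show False
  proof (cases i)
    case 0
    then show False using * jk assms(2)[of "xs ! j'"] by (auto dest: less_asym)
  next
    case (Suc i')
    then show False using * jk avoids213D[OF assms(1), of i' j' k'] by simp
  qed
qed

definition step_ok :: "'a::linorder set \<Rightarrow> 'a set \<Rightarrow> 'a \<Rightarrow> 'a \<Rightarrow> bool" where
  "step_ok D B a b \<longleftrightarrow> (if b < a then a \<in> D \<and> b \<in> B else a \<notin> D \<and> b \<notin> B)"

text \<open>Each step decides whether its left letter is a top and its right letter a bottom. The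
  last letter starts no step and the first one ends none, hence the two conditions on the
  ends.\<close>

lemma dtops_dbots_eqI:
  assumes "distinct xs" "successively (step_ok D B) xs" "D \<subseteq> set xs" "B \<subseteq> set xs"
    "hd xs \<notin> B" "last xs \<notin> D"
  shows "dtops xs = D" "dbots xs = B"
proof -
  have s: "step_ok D B (xs ! i) (xs ! Suc i)" if "Suc i < length xs" for i
    using assms(2) that by (simp add: successively_conv_nth)
  show "dtops xs = D"
  proof (intro equalityI subsetI)
    fix x assume "x \<in> dtops xs"
    then show "x \<in> D" using s by (auto simp: dtops_def step_ok_def split: if_splits)
  next
    fix x assume x: "x \<in> D"
    then obtain i where i: "i < length xs" "x = xs ! i" using assms(3) by (metis in_set_conv_nth subsetD)
    have "xs ! (length xs - 1) \<notin> D" using assms(6) i by (metis last_conv_nth length_greater_0_conv less_nat_zero_code list.size(3))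
    then have "i \<noteq> length xs - 1" using i x by metis
    then have "Suc i < length xs" using i by simp
    then show "x \<in> dtops xs" using s[of i] x i by (auto simp: dtops_def step_ok_def split: if_splits)
  qed
  show "dbots xs = B"
  proof (intro equalityI subsetI)
    fix x assume "x \<in> dbots xs"
    then show "x \<in> B" using s by (auto simp: dbots_def step_ok_def split: if_splits)
  next
    fix x assume x: "x \<in> B"
    then obtain i where i: "i < length xs" "x = xs ! i" using assms(4) by (metis in_set_conv_nth subsetD)
    have "i \<noteq> 0" using assms(5) i x by (metis hd_conv_nth length_greater_0_conv)
    then obtain j where "i = Suc j" using not0_implies_Suc by blast
    then show "x \<in> dbots xs" using s[of j] x i by (auto simp: dbots_def step_ok_def split: if_splits)
  qed
qed

text \<open>A run in the final word whose two neighbours are smaller letters still to be inserted.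
  So its first letter will not be a descent bottom and its last letter will be a descent
  top.\<close>

definition block :: "'a::linorder set \<Rightarrow> 'a set \<Rightarrow> 'a list \<Rightarrow> bool" where
  "block D B xs \<longleftrightarrow> xs \<noteq> [] \<and> distinct xs \<and> avoids213 xs \<and> hd xs \<notin> B \<and> last xs \<in> D \<and>
     successively (step_ok D B) xs"

lemma block_singleton: "y \<in> D \<Longrightarrow> y \<notin> B \<Longrightarrow> block D B [y]"
  by (simp add: block_def avoids213_def)

lemma block_snoc:
  assumes "block D B b" "y \<in> D" "y \<in> B" "\<And>x. x \<in> set b \<Longrightarrow> y < x"
  shows "block D B (b @ [y])"
  using assms avoids213_append[of b "[y]"]
  by (auto simp: block_def successively_append_iff step_ok_def avoids213_def)

lemma block_Cons:
  assumes "block D B b" "y \<notin> D" "y \<notin> B" "\<And>x. x \<in> set b \<Longrightarrow> y < x"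
  shows "block D B (y # b)"
  using assms avoids213_Cons[of b y] hd_in_set[of b]
  by (auto simp: block_def successively_Cons step_ok_def dest: less_asym)

text \<open>A valley joins two neighbouring runs. The run \<open>c\<close> with the larger letters
  stands on the left, so no 213 can straddle the junction.\<close>

lemma block_merge:
  assumes b: "block D B b" and c: "block D B c" and y: "y \<notin> D" "y \<in> B"
    and yb: "\<And>x. x \<in> set b \<Longrightarrow> y < x" and bc: "\<And>x z. x \<in> set b \<Longrightarrow> z \<in> set c \<Longrightarrow> x < z"
  shows "block D B (c @ y # b)"
proof -
  have ne: "b \<noteq> []" "c \<noteq> []" using b c by (auto simp: block_def)
  have yc: "y < z" if "z \<in> set c" for z
    using yb[of "hd b"] bc[of "hd b" z] ne that by (meson hd_in_set less_trans)
  have "avoids213 (c @ y # b)"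
    using b c yb yc bc by (intro avoids213_append avoids213_Cons) (auto simp: block_def)
  moreover have "distinct (c @ y # b)" using b c yb yc bc by (auto simp: block_def)
  moreover have "successively (step_ok D B) (c @ y # b)"
    using b c y ne yb[of "hd b"] yc[of "last c"]
    by (auto simp: block_def successively_append_iff successively_Cons step_ok_def dest: less_asym)
  ultimately show ?thesis using b c ne by (simp add: block_def)
qed

lemma card_ge_Suc:
  fixes A :: "nat set"
  assumes "finite A"
  shows "card {x \<in> A. y \<le> x} = card {x \<in> A. Suc y \<le> x} + (if y \<in> A then 1 else 0)"
proof -
  have "{x \<in> A. y \<le> x} = (if y \<in> A then insert y {x \<in> A. Suc y \<le> x} else {x \<in> A. Suc y \<le> x})"
    by (auto simp: Suc_le_eq le_less)
  then show ?thesis using assms by simp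
qed

text \<open>
  The letters are inserted in decreasing order. The list \<open>bs\<close> holds the maximal runs of already
  inserted letters in the final word, from right to left; avoiding 213 forces each new letter to
  interact only with the rightmost runs, and the counting inequality ensures that these exist.
\<close>
lemma ex_blocks:
  fixes D B :: "nat set"
  assumes fin: "D \<subseteq> {2..Suc n}" "B \<subseteq> {1..n}"
    and less: "\<And>y. 2 \<le> y \<Longrightarrow> y \<le> Suc n \<Longrightarrow> card {x \<in> B. y \<le> x} < card {x \<in> D. y \<le> x}"
    and "2 \<le> y" "y \<le> Suc (Suc n)"
  shows "\<exists>bs. (\<forall>b\<in>set bs. block D B b) \<and>
     sorted_wrt (\<lambda>b c. \<forall>x\<in>set b. \<forall>z\<in>set c. x < z) bs \<and>
     (\<Union>b\<in>set bs. set b) = {y..Suc n} \<and>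
     length bs + card {x \<in> B. y \<le> x} = card {x \<in> D. y \<le> x}"
  using \<open>y \<le> Suc (Suc n)\<close> \<open>2 \<le> y\<close>
proof (induction rule: inc_induct)
  case base
  have "{x \<in> B. Suc (Suc n) \<le> x} = {}" "{x \<in> D. Suc (Suc n) \<le> x} = {}" using fin by auto
  then show ?case by (intro exI[of _ "[]"]) (simp only: card.empty, simp)
next
  case (step y)
  then obtain bs where bs: "\<forall>b\<in>set bs. block D B b"
     "sorted_wrt (\<lambda>b c. \<forall>x\<in>set b. \<forall>z\<in>set c. x < z) bs"
     "(\<Union>b\<in>set bs. set b) = {Suc y..Suc n}"
     "length bs + card {x \<in> B. Suc y \<le> x} = card {x \<in> D. Suc y \<le> x}" by auto
  have y: "2 \<le> y" "y \<le> Suc n" using step by auto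
  note cB = card_ge_Suc[OF finite_subset[OF fin(2) finite_atLeastAtMost], of y]
  note cD = card_ge_Suc[OF finite_subset[OF fin(1) finite_atLeastAtMost], of y]
  \<comment> \<open>The number of runs is the difference of the two counts above \<open>y\<close>.
    The inequality at \<open>y\<close> thus yields at least one run for a double ascent or descent,
    and two for a valley.\<close>
  note c = less[OF y, unfolded cB cD] bs(4)
  have int: "{y..Suc n} = insert y {Suc y..Suc n}" using y by auto
  have ylt: "y < x" if "b \<in> set bs" "x \<in> set b" for b x
    using bs(3) that by (metis (no_types, lifting) UN_I Suc_le_eq atLeastAtMost_iff)
  \<comment> \<open>A peak opens a new rightmost run, a double descent ends the rightmost run, a
    double ascent begins it, and a valley merges the two rightmost runs.\<close>
  consider (peak) "y \<in> D" "y \<notin> B" | (ddes) "y \<in> D" "y \<in> B"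
    | (dasc) "y \<notin> D" "y \<notin> B" | (valley) "y \<notin> D" "y \<in> B" by blast
  then show ?case
  proof cases
    case peak
    then show ?thesis using bs ylt unfolding cB cD int
      by (intro exI[of _ "[y] # bs"]) (auto simp: block_singleton)
  next
    case ddes
    then obtain b cs where bcs: "bs = b # cs" using c by (cases bs) auto
    have "block D B (b @ [y])" using bs(1) ylt ddes bcs by (intro block_snoc) auto
    then show ?thesis using bs ylt ddes unfolding cB cD int bcs
      by (intro exI[of _ "(b @ [y]) # cs"]) auto
  next
    case dasc
    then obtain b cs where bcs: "bs = b # cs" using c by (cases bs) auto
    have "block D B (y # b)" using bs(1) ylt dasc bcs by (intro block_Cons) auto
    then show ?thesis using bs ylt dasc unfolding cB cD int bcs
      by (intro exI[of _ "(y # b) # cs"]) auto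
  next
    case valley
    then have "2 \<le> length bs" using c by simp
    then obtain b c cs where bcs: "bs = b # c # cs"
      by (metis One_nat_def Suc_1 Suc_le_length_iff)
    have "block D B (c @ y # b)" using bs(1,2) ylt valley bcs by (intro block_merge) auto
    then show ?thesis using bs ylt valley unfolding cB cD int bcs
      by (intro exI[of _ "(c @ y # b) # cs"]) auto
  qed
qed

lemma ex_hat_perm:
  fixes D B :: "nat set"
  assumes D: "D \<subseteq> {2..Suc n}" and B: "B \<subseteq> {1..n}" "1 \<in> B" and "card D = card B"
    and less: "\<And>y. 2 \<le> y \<Longrightarrow> y \<le> Suc n \<Longrightarrow> card {x \<in> B. y \<le> x} < card {x \<in> D. y \<le> x}"
  shows "\<exists>xs. hat_perm n xs \<and> dtops xs = D \<and> dbots xs = B"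
proof -
  have "1 \<le> n" using B by auto
  then obtain bs where bs: "\<forall>b\<in>set bs. block D B b"
     "(\<Union>b\<in>set bs. set b) = {2..Suc n}"
     "length bs + card {x \<in> B. 2 \<le> x} = card {x \<in> D. 2 \<le> x}"
    using ex_blocks[OF D B(1) less, of 2] by auto
  have "{x \<in> D. 2 \<le> x} = D" using D by auto
  \<comment> \<open>Only the bottom 1 is missing from the count at level 2. As \<open>D\<close> and
    \<open>B\<close> have equal size, exactly one run is left, and the letter 1 is appended to
    it.\<close>
  moreover have "B = insert 1 {x \<in> B. 2 \<le> x}" using B by force
  then have "card B = Suc (card {x \<in> B. 2 \<le> x})"
    by (metis (no_types, lifting) B(1) card_insert_disjoint finite_atLeastAtMost finite_insert finite_subset mem_Collect_eq not_less_eq_eq numeral_2_eq_2 One_nat_def le_refl)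
  ultimately have "length bs = 1" using bs(3) \<open>card D = card B\<close> by simp
  then obtain b where b: "bs = [b]" by (auto simp: length_Suc_conv)
  then have blk: "block D B b" and set: "set b = {2..Suc n}" using bs by auto
  let ?xs = "b @ [1]"
  have "1 \<notin> D" using D by auto
  have ne: "b \<noteq> []" using blk by (simp add: block_def)
  have dist: "distinct ?xs" using blk set by (simp add: block_def)
  have "last b \<in> set b" using ne by simp
  then have "1 < last b" using set by auto
  then have succ: "successively (step_ok D B) ?xs"
    using blk B by (simp add: block_def successively_append_iff step_ok_def)
  have "insert 1 {2..Suc n} = {1..Suc n}" by auto
  then have set_xs: "set ?xs = {1..Suc n}" using set by simp
  have "D \<subseteq> set ?xs" "B \<subseteq> set ?xs"
    unfolding set_xs by (rule order_trans[OF D], simp) (rule order_trans[OF B(1)], simp)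
  moreover have "hd ?xs \<notin> B" "last ?xs \<notin> D"
    using \<open>1 \<notin> D\<close> blk by (simp_all add: block_def)
  ultimately have "dtops ?xs = D" "dbots ?xs = B"
    by (rule dtops_dbots_eqI[OF dist succ])+
  moreover have "avoids213 ?xs"
    using blk set by (intro avoids213_append) (auto simp: block_def avoids213_def)
  then have "hat_perm n ?xs" using dist set_xs by unfold_locales auto
  ultimately show ?thesis by blast
qed

section \<open>Bijectivity\<close>

lemma avoids213_map_Suc: "avoids213 (map Suc xs) \<longleftrightarrow> avoids213 xs"
  by (auto simp: avoids213_def)

lemma hat_perm_map_Suc:
  assumes "s \<in> avoiding n [2,1,3]"
  shows "hat_perm n (map Suc s @ [1])"
proof
  have s: "distinct s" "set s = {1..n}" "avoids213 s" using assms by (simp_all only: avoiding_213)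
  show "distinct (map Suc s @ [1])" using s by (auto simp: distinct_map)
  show "set (map Suc s @ [1]) = {1..Suc n}" using s(2)
    by (auto simp: image_Suc_atLeastAtMost)
  show "avoids213 (map Suc s @ [1])"
    using s by (intro avoids213_append) (auto simp: avoids213_map_Suc, auto simp: avoids213_def)
qed simp

lemma (in hat_perm) ex_map_Suc: "\<exists>s \<in> avoiding n [2,1,3]. xs = map Suc s @ [1]"
proof -
  obtain b where xs: "xs = b @ [1]"
    using last_xs length_xs by (metis append_butlast_last_id length_0_conv nat.distinct(1))
  let ?s = "map (\<lambda>x. x - 1) b"
  have d: "distinct b" "1 \<notin> set b" using dist unfolding xs by auto
  have "insert 1 (set b) = {1..Suc n}" using set_xs unfolding xs by simp
  moreover have "insert 1 (set b) - {1} = set b" using d(2) by (rule Diff_insert_absorb)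
  moreover have "{1..Suc n} - {1} = {2..Suc n}" by auto
  ultimately have sb: "set b = {2..Suc n}" by simp
  have m: "map Suc ?s = b" using sb by (auto intro!: map_idI)
  then have xs_eq: "xs = map Suc ?s @ [1]" using xs by simp
  have "avoids213 b" using avoids213_appendD av unfolding xs by blast
  then have "avoids213 ?s" by (metis m avoids213_map_Suc)
  moreover have "distinct ?s" using d m by (metis distinct_map)
  moreover have "Suc ` set ?s = Suc ` {1..n}"
    using m sb by (metis image_Suc_atLeastAtMost list.set_map numeral_2_eq_2 One_nat_def)
  then have "set ?s = {1..n}" by (simp only: inj_image_eq_iff[OF inj_Suc])
  ultimately have "?s \<in> avoiding n [2,1,3]" by (simp only: avoiding_213 simp_thms)
  with xs_eq show ?thesis by blast
qed

lemma Psi_surj: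
  assumes "1 \<le> n" and w: "w \<in> avoiding n [3,2,1]"
  shows "\<exists>s \<in> avoiding n [2,1,3]. Psi s = w"
proof -
  have dw: "distinct w" and set_w: "set w = {1..n}" and av: "avoids321 w"
    using w by (simp_all only: avoiding_321)
  have len: "length w = n" using distinct_card[OF dw] set_w by simp
  define p where "p = (\<lambda>b. w ! (b - 2))"
  have inj: "inj_on p {2..Suc n}"
    unfolding p_def using dw len by (auto simp: inj_on_def nth_eq_iff_index_eq)
  have im: "p ` {2..Suc n} = {1..n}"
  proof -
    have "p ` {2..Suc n} \<subseteq> {1..n}" unfolding p_def using set_w len by (force dest: nth_mem)
    moreover have "card (p ` {2..Suc n}) = card {1..n}" using card_image[OF inj] by simp
    ultimately show ?thesis by (simp add: card_subset_eq)
  qed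
  have p_in: "p b \<in> {1..n}" if "b \<in> {2..Suc n}" for b using im that by blast
  have p_neq: "p a \<noteq> p b" if "a \<in> {2..Suc n}" "b \<in> {2..Suc n}" "a \<noteq> b" for a b
    using inj that by (auto dest: inj_onD)
  have p321: False if "a < b" "b < c" "2 \<le> a" "c \<le> Suc n" "p c < p b" "p b < p a" for a b c
  proof (rule avoids321D[OF av])
    show "a - 2 < b - 2" "b - 2 < c - 2" "c - 2 < length w" using that len by linarith+
  qed (use that in \<open>simp_all add: p_def\<close>)
  have pigeon: "card A \<le> card C" if "A \<subseteq> {2..Suc n}" "p ` A \<subseteq> C" "finite C" for A C
    using that by (intro card_inj_on_le[of p A C]) (auto intro: inj_on_subset[OF inj])
  \<comment> \<open>This choice is forced by \<open>tl_Phi_less_iff\<close>, and then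
    \<open>B\<close> has to be the image of \<open>D\<close>.\<close>
  define D where "D = {b \<in> {2..Suc n}. p b < b}"
  define B where "B = p ` D"
  have D: "D \<subseteq> {2..Suc n}" by (auto simp: D_def)
  have B: "B \<subseteq> {1..n}" using p_in D unfolding B_def by blast
  have card: "card D = card B" unfolding B_def using inj_on_subset[OF inj D] by (simp add: card_image)
  have "1 \<in> p ` {2..Suc n}" using im \<open>1 \<le> n\<close> by simp
  then have "1 \<in> B" by (force simp: B_def D_def)
  have less: "card {x \<in> B. y \<le> x} < card {x \<in> D. y \<le> x}" if y: "2 \<le> y" "y \<le> Suc n" for y
  proof -
    have "{x \<in> B. y \<le> x} = p ` {x \<in> D. y \<le> p x}" by (auto simp: B_def)
    then have "card {x \<in> B. y \<le> x} = card {x \<in> D. y \<le> p x}"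
      using D by (auto intro!: card_image inj_on_subset[OF inj])
    also have "\<dots> < card {x \<in> D. y \<le> x}"
    proof (rule psubset_card_mono)
      show "finite {x \<in> D. y \<le> x}" using finite_subset[OF D] by simp
      \<comment> \<open>The target has one element less, so some \<open>x\<close> with
        \<open>y <= x\<close> has its value below \<open>y\<close>. This \<open>x\<close> makes the
        inclusion strict.\<close>
      have "\<not> p ` {y..Suc n} \<subseteq> {y..n}" using pigeon[of "{y..Suc n}" "{y..n}"] y by auto
      then obtain x where x: "x \<in> {y..Suc n}" "p x \<notin> {y..n}" by (meson image_subsetI)
      then have "p x < y" using p_in[of x] y by auto
      then have "x \<in> {x \<in> D. y \<le> x}" "x \<notin> {x \<in> D. y \<le> p x}" using x y by (auto simp: D_def)
      moreover have "{x \<in> D. y \<le> p x} \<subseteq> {x \<in> D. y \<le> x}" by (auto simp: D_def)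
      ultimately show "{x \<in> D. y \<le> p x} \<subset> {x \<in> D. y \<le> x}" by blast
    qed
    finally show ?thesis .
  qed
  have monoD: "strict_mono_on D p"
  proof (rule strict_mono_onI, rule ccontr)
    fix a b assume ab: "a \<in> D" "b \<in> D" "a < b" "\<not> p a < p b"
    then have ba: "p b < p a" using p_neq[of a b] D by force
    have ran: "2 \<le> a" "b \<le> Suc n" "p a < a" using ab by (auto simp: D_def)
    \<comment> \<open>The source has \<open>a - 1\<close> elements and the target only
      \<open>a - 2\<close>. So some \<open>c < a\<close> has a value at least \<open>a\<close>, and
      \<open>c\<close>, \<open>a\<close>, \<open>b\<close> carry a 321.\<close>
    have "\<not> p ` {2..a} \<subseteq> {1..<a} - {p b}"
    proof
      assume "p ` {2..a} \<subseteq> {1..<a} - {p b}"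
      then have "card {2..a} \<le> card ({1..<a} - {p b})"
        using ran ab by (intro pigeon) auto
      moreover have "p b \<in> {1..<a}" using p_in[of b] ran ba ab by auto
      then have "card ({1..<a} - {p b}) = a - 2" by simp
      ultimately show False using \<open>2 \<le> a\<close> by simp
    qed
    then obtain c where c: "c \<in> {2..a}" "p c \<notin> {1..<a} - {p b}" by (meson image_subsetI)
    have "p c \<noteq> p b" using p_neq[of c b] c ran ab by auto
    then have "a \<le> p c" using c p_in[of c] ran ab by auto
    then have "c \<noteq> a" using ran by auto
    then show False using p321[of c a b] c ran ab ba \<open>a \<le> p c\<close> by auto
  qed
  have monoT: "strict_mono_on ({2..Suc n} - D) p"
  proof (rule strict_mono_onI, rule ccontr)
    fix a b assume ab: "a \<in> {2..Suc n} - D" "b \<in> {2..Suc n} - D" "a < b" "\<not> p a < p b"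
    then have ba: "p b < p a" using p_neq[of a b] by force
    have ran: "2 \<le> a" "b \<le> Suc n" "b \<le> p b" using ab by (auto simp: D_def)
    \<comment> \<open>Since \<open>b <= p b\<close> and \<open>p a\<close> is removed, the target is
      too small. So some \<open>c > b\<close> has a value below \<open>p b\<close>, and
      \<open>a\<close>, \<open>b\<close>, \<open>c\<close> carry a 321.\<close>
    have "\<not> p ` {Suc b..Suc n} \<subseteq> {Suc (p b)..n} - {p a}"
    proof
      assume "p ` {Suc b..Suc n} \<subseteq> {Suc (p b)..n} - {p a}"
      then have "card {Suc b..Suc n} \<le> card ({Suc (p b)..n} - {p a})"
        using ran ab by (intro pigeon) auto
      moreover have "p a \<in> {Suc (p b)..n}" using p_in[of a] ran ba ab by auto
      ultimately show False using ran by auto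
    qed
    then obtain c where c: "c \<in> {Suc b..Suc n}" "p c \<notin> {Suc (p b)..n} - {p a}" by (meson image_subsetI)
    have "p c \<noteq> p a" "p c \<noteq> p b" using p_neq[of c a] p_neq[of c b] c ran ab by auto
    then have "p c < p b" using c p_in[of c] ran ab by auto
    then show False using p321[of a b c] c ran ab ba by auto
  qed
  have imT: "p ` ({2..Suc n} - D) = {1..n} - B"
    unfolding B_def im[symmetric] by (rule inj_on_image_set_diff[OF inj]) (use D in auto)
  obtain xs where xs: "hat_perm n xs" "dtops xs = D" "dbots xs = B"
    using ex_hat_perm[OF D B \<open>1 \<in> B\<close> card less] by blast
  interpret hat_perm n xs by fact
  obtain s where s: "s \<in> avoiding n [2,1,3]" "xs = map Suc s @ [1]" using ex_map_Suc by blast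
  define q where "q = (\<lambda>b. tl (Phi xs) ! (b - 2))"
  note q = tl_Phi(2-)[folded q_def, unfolded xs]
  have finD: "finite D" "finite B" using finite_subset[OF D] finite_subset[OF B] by auto
  \<comment> \<open>On \<open>D\<close>, and then on its complement, \<open>p\<close> and
    \<open>q\<close> are increasing with the same image, hence equal.\<close>
  have "map q (sorted_list_of_set D) = map p (sorted_list_of_set D)"
    using map_sorted_list_of_set_eq_iff[OF finD, of p] map_sorted_list_of_set_eq_iff[OF finD, of q]
      q monoD B_def by simp
  then have "q b = p b" if "b \<in> D" for b using that finD by simp
  moreover have "map q (sorted_list_of_set ({2..Suc n} - D)) = map p (sorted_list_of_set ({2..Suc n} - D))"
    using map_sorted_list_of_set_eq_iff[of "{2..Suc n} - D" "{1..n} - B" p]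
      map_sorted_list_of_set_eq_iff[of "{2..Suc n} - D" "{1..n} - B" q] q monoT imT by simp
  then have "q b = p b" if "b \<in> {2..Suc n} - D" for b using that by simp
  ultimately have qp: "q b = p b" if "b \<in> {2..Suc n}" for b using that by blast
  have "tl (Phi xs) = w"
  proof (rule nth_equalityI)
    show "length (tl (Phi xs)) = length w" using tl_Phi(1) len by simp
    fix i assume "i < length (tl (Phi xs))"
    then show "tl (Phi xs) ! i = w ! i" using qp[of "i + 2"] tl_Phi(1) by (simp add: p_def q_def)
  qed
  then show ?thesis using s by (auto simp: Psi_def)
qed

text \<open>The image word determines the descent tops through \<open>tl_Phi_less_iff\<close>, then
  the descent bottoms as their image, and these two sets determine the word by
  \<open>hat_perm_eqI\<close>.\<close>

lemma Psi_inj: "inj_on Psi (avoiding n [2,1,3])"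
proof (rule inj_onI)
  fix s t assume st: "s \<in> avoiding n [2,1,3]" "t \<in> avoiding n [2,1,3]" "Psi s = Psi t"
  let ?xs = "map Suc s @ [1]" let ?ys = "map Suc t @ [1]"
  interpret X: hat_perm n ?xs using st by (intro hat_perm_map_Suc)
  interpret Y: hat_perm n ?ys using st by (intro hat_perm_map_Suc)
  have eq: "tl (Phi ?xs) = tl (Phi ?ys)" using st(3) by (simp add: Psi_def)
  have D: "dtops ?xs = dtops ?ys"
  proof (rule set_eqI)
    fix b
    show "b \<in> dtops ?xs \<longleftrightarrow> b \<in> dtops ?ys"
      using X.tl_Phi_less_iff[of b] Y.tl_Phi_less_iff[of b] X.dtops_sub Y.dtops_sub eq
      by (cases "b \<in> {2..Suc n}") auto
  qed
  have "dbots ?xs = dbots ?ys"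
    using X.tl_Phi(3) Y.tl_Phi(3) unfolding eq D by simp
  then have "?xs = ?ys" using D by (intro hat_perm_eqI[of n]) unfold_locales
  then show "s = t" by (simp add: inj_map_eq_map)
qed

theorem theorem2p12:
  fixes n :: nat
  assumes "n \<ge> 1"
  shows "bij_betw Psi (avoiding n [2,1,3]) (avoiding n [3,2,1])"
  unfolding bij_betw_def
proof (intro conjI equalityI subsetI)
  show "inj_on Psi (avoiding n [2,1,3])" by (rule Psi_inj)
next
  fix w assume "w \<in> Psi ` avoiding n [2,1,3]"
  then obtain s where "s \<in> avoiding n [2,1,3]" "w = Psi s" by blast
  then show "w \<in> avoiding n [3,2,1]"
    unfolding Psi_def using hat_perm.tl_Phi_avoiding[OF hat_perm_map_Suc] by blast
next
  fix w assume "w \<in> avoiding n [3,2,1]"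
  then show "w \<in> Psi ` avoiding n [2,1,3]" using Psi_surj[OF assms] by blast
qed

end
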